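(* Let $K$ be the Kronecker quiver, i.e. the quiver with vertices $1,2$ and two arrows $\alpha,\beta:1\to 2$. Let $S$ be the unilateral shift on $\mathcal{H}=\ell^2(\mathbb{N})$ with canonical basis $\{e_1,e_2,\dots\}$, so $Se_n=e_{n+1}$. Let $\lambda=(\lambda_1,\lambda_2,\dots)\in\ell^\infty$ be a bounded sequence of complex numbers with $\lambda_i\neq\lambda_j$ whenever $i\neq j$, and let $D_\lambda=\mathrm{diag}(\lambda_1,\lambda_2,\dots)$ be the associated diagonal operator. Let $\overline{w}=(\overline{w_n})_n\in\ell^2(\mathbb{N})$ be a vector such that $w_n\neq 0$ for every $n\in\mathbb{N}$. Let $(H,f)$ be the Hilbert representation of $K$ given by $H_1=H_2=\mathcal{H}$, $f_\alpha=S$ and $f_\beta=T:=SD_\lambda+\theta_{e_1,\overline{w}}$. Then $(H,f)$ is transitive, i.e. $End(H,f)=\mathbb{C}I$.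
   Context: All Hilbert spaces are complex. For vectors $a,b$ in a Hilbert space, with inner product $(\cdot\mid\cdot)$ linear in the first variable, $\theta_{a,b}$ is the rank-one operator $\theta_{a,b}(x)=(x\mid b)a$. A Hilbert representation $(H,f)$ of the Kronecker quiver consists of two Hilbert spaces $H_1,H_2$ and two bounded linear operators $f_\alpha,f_\beta:H_1\to H_2$. An endomorphism of $(H,f)$ is a pair $(T_1,T_2)$ of bounded operators $T_i\in B(H_i)$ with $T_2f_\alpha=f_\alpha T_1$ and $T_2f_\beta=f_\beta T_1$; $End(H,f)$ denotes the algebra of all endomorphisms and $I=(I_{H_1},I_{H_2})$. The representation $(H,f)$ is called transitive if $End(H,f)=\mathbb{C}I$. *)

theory Defs
  imports "HOL-Analysis.Analysis"
begin

section \<open>Complex Hilbert spaces\<close>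

text \<open>The inner product \<open>cinner\<close> is linear in the first variable. The underlying real Hilbert
  space carries the inner product \<open>Re (cinner x y)\<close>, hence \<open>norm x = sqrt (Re (cinner x x))\<close>, and
  positive definiteness of \<open>cinner\<close> is inherited from \<^class>\<open>real_inner\<close>.\<close>

class complex_hilbert = real_inner + complete_space +
  fixes scaleC :: "complex \<Rightarrow> 'a \<Rightarrow> 'a"  (infixr "*\<^sub>C" 75)
    and cinner :: "'a \<Rightarrow> 'a \<Rightarrow> complex"
  assumes scaleC_add_right: "c *\<^sub>C (x + y) = c *\<^sub>C x + c *\<^sub>C y"
    and scaleC_add_left: "(c + d) *\<^sub>C x = c *\<^sub>C x + d *\<^sub>C x"
    and scaleC_scaleC: "c *\<^sub>C d *\<^sub>C x = (c * d) *\<^sub>C x"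
    and scaleR_scaleC: "r *\<^sub>R x = complex_of_real r *\<^sub>C x"
    and cinner_commute: "cinner x y = cnj (cinner y x)"
    and cinner_add_left: "cinner (x + y) z = cinner x z + cinner y z"
    and cinner_scaleC_left: "cinner (c *\<^sub>C x) y = c * cinner x y"
    and inner_eq_Re_cinner: "inner x y = Re (cinner x y)"

text \<open>In \<^const>\<open>bounded_linear\<close>, linearity is over the reals.\<close>

definition bounded_clinear :: "('a::complex_hilbert \<Rightarrow> 'b::complex_hilbert) \<Rightarrow> bool" where
  "bounded_clinear f \<longleftrightarrow> bounded_linear f \<and> (\<forall>c x. f (c *\<^sub>C x) = c *\<^sub>C f x)"

definition rank_one :: "'b \<Rightarrow> 'a \<Rightarrow> 'a::complex_hilbert \<Rightarrow> 'b::complex_hilbert" where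
  "rank_one a b = (\<lambda>x. cinner x b *\<^sub>C a)"


section \<open>Hilbert representations of the Kronecker quiver\<close>

text \<open>The two Hilbert spaces of a representation are the types \<open>'a\<close> (at vertex 1) and \<open>'b\<close>
  (at vertex 2); \<open>fa\<close> and \<open>fb\<close> are the operators attached to the two arrows.\<close>

definition kronecker_rep ::
  "('a::complex_hilbert \<Rightarrow> 'b::complex_hilbert) \<Rightarrow> ('a \<Rightarrow> 'b) \<Rightarrow> bool" where
  "kronecker_rep fa fb \<longleftrightarrow> bounded_clinear fa \<and> bounded_clinear fb"

definition End ::
  "('a::complex_hilbert \<Rightarrow> 'b::complex_hilbert) \<Rightarrow> ('a \<Rightarrow> 'b) \<Rightarrow> (('a \<Rightarrow> 'a) \<times> ('b \<Rightarrow> 'b)) set" where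
  "End fa fb = {(T1, T2). bounded_clinear T1 \<and> bounded_clinear T2 \<and>
     T2 \<circ> fa = fa \<circ> T1 \<and> T2 \<circ> fb = fb \<circ> T1}"

definition transitive_rep ::
  "('a::complex_hilbert \<Rightarrow> 'b::complex_hilbert) \<Rightarrow> ('a \<Rightarrow> 'b) \<Rightarrow> bool" where
  "transitive_rep fa fb \<longleftrightarrow> End fa fb = {((\<lambda>x. c *\<^sub>C x), (\<lambda>y. c *\<^sub>C y)) | c. True}"


section \<open>The Hilbert space of square-summable complex sequences\<close>

text \<open>Sequences are indexed from 0: coordinate \<open>n\<close> is the coefficient of the basis vector
  usually written with index \<open>n + 1\<close>.\<close>

typedef ell2 = "{x :: nat \<Rightarrow> complex. summable (\<lambda>n. (cmod (x n))\<^sup>2)}"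
  morphisms ell2_nth Abs_ell2
  by (rule exI[of _ "\<lambda>_. 0"]) simp

setup_lifting type_definition_ell2

lemma ell2_eqI: "(\<And>n. ell2_nth x n = ell2_nth y n) \<Longrightarrow> x = y"
  by (metis ell2_nth_inject ext)

lemma summable_ell2_nth: "summable (\<lambda>n. (cmod (ell2_nth x n))\<^sup>2)"
  using ell2_nth by blast

lemma square_summable_add:
  assumes "summable (\<lambda>n. (cmod (x n))\<^sup>2)" "summable (\<lambda>n. (cmod (y n))\<^sup>2)"
  shows "summable (\<lambda>n. (cmod (x n + y n))\<^sup>2)"
proof (rule summable_comparison_test')
  show "summable (\<lambda>n. 2 * ((cmod (x n))\<^sup>2 + (cmod (y n))\<^sup>2))"
    using assms by (intro summable_mult summable_add)
  fix n
  have "(cmod (x n + y n))\<^sup>2 \<le> (cmod (x n) + cmod (y n))\<^sup>2"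
    by (intro power_mono norm_triangle_ineq norm_ge_zero)
  also have "\<dots> \<le> 2 * ((cmod (x n))\<^sup>2 + (cmod (y n))\<^sup>2)"
    using sum_squares_bound[of "cmod (x n)" "cmod (y n)"] by (simp add: power2_sum)
  finally show "norm ((cmod (x n + y n))\<^sup>2) \<le> 2 * ((cmod (x n))\<^sup>2 + (cmod (y n))\<^sup>2)"
    by simp
qed

lemma square_summable_mult:
  assumes "summable (\<lambda>n. (cmod (x n))\<^sup>2)" "bounded (range l)"
  shows "summable (\<lambda>n. (cmod (l n * x n))\<^sup>2)"
proof -
  obtain B where B: "\<And>n. cmod (l n) \<le> B"
    using assms(2) by (auto simp: bounded_iff)
  show ?thesis
  proof (rule summable_comparison_test')
    show "summable (\<lambda>n. B\<^sup>2 * (cmod (x n))\<^sup>2)"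
      using assms(1) by (rule summable_mult)
    show "norm ((cmod (l n * x n))\<^sup>2) \<le> B\<^sup>2 * (cmod (x n))\<^sup>2" for n
      using B[of n] by (auto simp: norm_mult power_mult_distrib intro!: mult_right_mono power_mono)
  qed
qed

lemma square_summable_cscale:
  "summable (\<lambda>n. (cmod (x n))\<^sup>2) \<Longrightarrow> summable (\<lambda>n. (cmod (c * x n))\<^sup>2)"
  by (rule square_summable_mult) auto

lemma summable_ell2_prod: "summable (\<lambda>n. ell2_nth x n * cnj (ell2_nth y n))"
proof (rule summable_comparison_test')
  show "summable (\<lambda>n. (cmod (ell2_nth x n))\<^sup>2 + (cmod (ell2_nth y n))\<^sup>2)"
    by (intro summable_add summable_ell2_nth)
  show "norm (ell2_nth x n * cnj (ell2_nth y n)) \<le> (cmod (ell2_nth x n))\<^sup>2 + (cmod (ell2_nth y n))\<^sup>2" for n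
    using sum_squares_bound[of "cmod (ell2_nth x n)" "cmod (ell2_nth y n)"]
      mult_nonneg_nonneg[OF norm_ge_zero[of "ell2_nth x n"] norm_ge_zero[of "ell2_nth y n"]]
    unfolding norm_mult complex_mod_cnj by linarith
qed

instantiation ell2 :: real_vector
begin

lift_definition zero_ell2 :: ell2 is "\<lambda>_. 0" by simp
lift_definition plus_ell2 :: "ell2 \<Rightarrow> ell2 \<Rightarrow> ell2" is "\<lambda>x y n. x n + y n"
  by (rule square_summable_add)
lift_definition uminus_ell2 :: "ell2 \<Rightarrow> ell2" is "\<lambda>x n. - x n" by simp
lift_definition minus_ell2 :: "ell2 \<Rightarrow> ell2 \<Rightarrow> ell2" is "\<lambda>x y n. x n - y n"
proof -
  fix x y :: "nat \<Rightarrow> complex"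
  assume "summable (\<lambda>n. (cmod (x n))\<^sup>2)" "summable (\<lambda>n. (cmod (y n))\<^sup>2)"
  then show "summable (\<lambda>n. (cmod (x n - y n))\<^sup>2)"
    using square_summable_add[of x "\<lambda>n. - y n"] by simp
qed
lift_definition scaleR_ell2 :: "real \<Rightarrow> ell2 \<Rightarrow> ell2" is "\<lambda>r x n. complex_of_real r * x n"
  by (rule square_summable_cscale)

instance
proof
  fix x y z :: ell2 and r s :: real
  show "x + y + z = x + (y + z)" by transfer (simp add: add.assoc)
  show "x + y = y + x" by transfer (simp add: add.commute)
  show "0 + x = x" by transfer simp
  show "- x + x = 0" by transfer simp
  show "x - y = x + - y" by transfer simp
  show "r *\<^sub>R (x + y) = r *\<^sub>R x + r *\<^sub>R y" by transfer (simp add: algebra_simps)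
  show "(r + s) *\<^sub>R x = r *\<^sub>R x + s *\<^sub>R x" by transfer (simp add: algebra_simps)
  show "r *\<^sub>R s *\<^sub>R x = (r * s) *\<^sub>R x" by transfer (simp add: algebra_simps)
  show "1 *\<^sub>R x = x" by transfer simp
qed

end

instantiation ell2 :: real_inner
begin

definition inner_ell2 :: "ell2 \<Rightarrow> ell2 \<Rightarrow> real" where
  "inner_ell2 x y = Re (\<Sum>n. ell2_nth x n * cnj (ell2_nth y n))"
definition norm_ell2 :: "ell2 \<Rightarrow> real" where
  "norm_ell2 x = sqrt (inner x x)"
definition sgn_ell2 :: "ell2 \<Rightarrow> ell2" where
  "sgn_ell2 x = x /\<^sub>R norm x"
definition dist_ell2 :: "ell2 \<Rightarrow> ell2 \<Rightarrow> real" where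
  "dist_ell2 x y = norm (x - y)"
definition uniformity_ell2 :: "(ell2 \<times> ell2) filter" where
  "uniformity_ell2 = (INF e\<in>{0<..}. principal {(x, y). dist x y < e})"
definition open_ell2 :: "ell2 set \<Rightarrow> bool" where
  "open_ell2 U \<longleftrightarrow> (\<forall>x\<in>U. eventually (\<lambda>(x', y). x' = x \<longrightarrow> y \<in> U) uniformity)"

lemma inner_ell2_self: "inner x x = (\<Sum>n. (cmod (ell2_nth x n))\<^sup>2)" for x :: ell2
proof -
  have "(\<Sum>n. ell2_nth x n * cnj (ell2_nth x n)) = complex_of_real (\<Sum>n. (cmod (ell2_nth x n))\<^sup>2)"
    by (subst suminf_of_real[OF summable_ell2_nth]) (simp only: complex_norm_square)
  then show ?thesis by (simp only: inner_ell2_def Re_complex_of_real)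
qed

instance
proof
  fix x y z :: ell2 and r :: real
  show "dist x y = norm (x - y)" by (rule dist_ell2_def)
  show "sgn x = x /\<^sub>R norm x" by (rule sgn_ell2_def)
  show "uniformity = (INF e\<in>{0<..}. principal {(x::ell2, y). dist x y < e})"
    by (rule uniformity_ell2_def)
  show "open U \<longleftrightarrow> (\<forall>x\<in>U. eventually (\<lambda>(x', y). x' = x \<longrightarrow> y \<in> U) uniformity)" for U :: "ell2 set"
    by (rule open_ell2_def)
  show "norm x = sqrt (inner x x)" by (rule norm_ell2_def)
  have Re_inner: "inner x y = (\<Sum>n. Re (ell2_nth x n * cnj (ell2_nth y n)))" for x y :: ell2
    unfolding inner_ell2_def by (rule bounded_linear.suminf[OF bounded_linear_Re summable_ell2_prod])
  show "inner x y = inner y x" unfolding Re_inner by (simp add: mult.commute)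
  show "inner (x + y) z = inner x z + inner y z"
    unfolding inner_ell2_def
    by (simp add: plus_ell2.rep_eq distrib_right flip: suminf_add[OF summable_ell2_prod summable_ell2_prod])
  have "(\<Sum>n. ell2_nth (r *\<^sub>R x) n * cnj (ell2_nth y n))
      = of_real r * (\<Sum>n. ell2_nth x n * cnj (ell2_nth y n))"
    by (simp add: scaleR_ell2.rep_eq mult.assoc suminf_mult[OF summable_ell2_prod])
  then show "inner (r *\<^sub>R x) y = r * inner x y"
    unfolding inner_ell2_def by simp
  show "0 \<le> inner x x"
    unfolding inner_ell2_self by (intro suminf_nonneg summable_ell2_nth) simp
  show "inner x x = 0 \<longleftrightarrow> x = 0"
    unfolding inner_ell2_self using suminf_eq_zero_iff[OF summable_ell2_nth, of x]
    by (auto simp: zero_ell2.rep_eq intro: ell2_eqI)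
qed

end

lemma norm_ell2_sq: "(norm x)\<^sup>2 = (\<Sum>n. (cmod (ell2_nth x n))\<^sup>2)" for x :: ell2
  by (simp add: power2_norm_eq_inner inner_ell2_self)

lemma sum_le_norm_ell2: "(\<Sum>n<k. (cmod (ell2_nth x n))\<^sup>2) \<le> (norm x)\<^sup>2"
  unfolding norm_ell2_sq by (intro sum_le_suminf summable_ell2_nth) auto

lemma cmod_nth_le_norm_ell2: "cmod (ell2_nth x n) \<le> norm x"
proof -
  have "(cmod (ell2_nth x n))\<^sup>2 \<le> (\<Sum>i<Suc n. (cmod (ell2_nth x i))\<^sup>2)"
    by (rule member_le_sum) auto
  also note sum_le_norm_ell2
  finally show ?thesis by (rule power2_le_imp_le) simp
qed

instance ell2 :: complete_space
proof
  fix X :: "nat \<Rightarrow> ell2"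
  assume X: "Cauchy X"
  have "\<exists>l. (\<lambda>k. ell2_nth (X k) n) \<longlonglongrightarrow> l" for n
  proof -
    have "Cauchy (\<lambda>k. ell2_nth (X k) n)"
    proof (rule metric_CauchyI)
      fix e :: real assume "0 < e"
      then obtain M where M: "\<And>i j. i \<ge> M \<Longrightarrow> j \<ge> M \<Longrightarrow> dist (X i) (X j) < e"
        using metric_CauchyD[OF X] by blast
      have "dist (ell2_nth (X i) n) (ell2_nth (X j) n) \<le> dist (X i) (X j)" for i j
        using cmod_nth_le_norm_ell2[of "X i - X j" n] by (simp add: dist_norm minus_ell2.rep_eq)
      then show "\<exists>M. \<forall>i\<ge>M. \<forall>j\<ge>M. dist (ell2_nth (X i) n) (ell2_nth (X j) n) < e"
        using M by (meson order_le_less_trans)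
    qed
    then show ?thesis by (simp add: Cauchy_convergent_iff convergent_def)
  qed
  then obtain l where l: "\<And>n. (\<lambda>k. ell2_nth (X k) n) \<longlonglongrightarrow> l n" by metis
  have tail: "\<exists>M. \<forall>i\<ge>M. \<forall>k. (\<Sum>n<k. (cmod (ell2_nth (X i) n - l n))\<^sup>2) \<le> e\<^sup>2" if "0 < e" for e :: real
  proof -
    obtain M where M: "\<And>i j. i \<ge> M \<Longrightarrow> j \<ge> M \<Longrightarrow> dist (X i) (X j) < e"
      using metric_CauchyD[OF X \<open>0 < e\<close>] by blast
    have "(\<Sum>n<k. (cmod (ell2_nth (X i) n - l n))\<^sup>2) \<le> e\<^sup>2" if "i \<ge> M" for i k
    proof (rule LIMSEQ_le_const2)
      show "(\<lambda>j. \<Sum>n<k. (cmod (ell2_nth (X i) n - ell2_nth (X j) n))\<^sup>2)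
          \<longlonglongrightarrow> (\<Sum>n<k. (cmod (ell2_nth (X i) n - l n))\<^sup>2)"
        by (intro tendsto_intros l)
      show "\<exists>N. \<forall>j\<ge>N. (\<Sum>n<k. (cmod (ell2_nth (X i) n - ell2_nth (X j) n))\<^sup>2) \<le> e\<^sup>2"
      proof (intro exI allI impI)
        fix j assume "j \<ge> M"
        have "(\<Sum>n<k. (cmod (ell2_nth (X i) n - ell2_nth (X j) n))\<^sup>2) \<le> (norm (X i - X j))\<^sup>2"
          using sum_le_norm_ell2[of "X i - X j" k] by (simp add: minus_ell2.rep_eq)
        also have "\<dots> \<le> e\<^sup>2"
          using M[OF \<open>i \<ge> M\<close> \<open>j \<ge> M\<close>] by (intro power_mono) (auto simp: dist_norm)
        finally show "(\<Sum>n<k. (cmod (ell2_nth (X i) n - ell2_nth (X j) n))\<^sup>2) \<le> e\<^sup>2" .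
      qed
    qed
    then show ?thesis by blast
  qed
  have summ: "summable (\<lambda>n. (cmod (ell2_nth (X i) n - l n))\<^sup>2)"
    if "\<And>k. (\<Sum>n<k. (cmod (ell2_nth (X i) n - l n))\<^sup>2) \<le> B" for i B
    using that
    by (intro bounded_imp_summable[where B = B]) (simp_all only: zero_le_power2 flip: lessThan_Suc_atMost)
  obtain i where "\<And>k. (\<Sum>n<k. (cmod (ell2_nth (X i) n - l n))\<^sup>2) \<le> 1\<^sup>2"
    using tail[of 1] by auto
  then have "summable (\<lambda>n. (cmod (ell2_nth (X i) n - l n))\<^sup>2)" by (rule summ)
  then have "summable (\<lambda>n. (cmod (- (ell2_nth (X i) n - l n)))\<^sup>2)" by (simp only: norm_minus_cancel)
  from square_summable_add[OF summable_ell2_nth[of "X i"] this]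
  have "summable (\<lambda>n. (cmod (l n))\<^sup>2)" by simp
  then have L: "ell2_nth (Abs_ell2 l) = l" by (simp add: Abs_ell2_inverse)
  have "X \<longlonglongrightarrow> Abs_ell2 l"
  proof (rule metric_LIMSEQ_I)
    fix e :: real assume "0 < e"
    then obtain M where M: "\<And>i k. i \<ge> M \<Longrightarrow> (\<Sum>n<k. (cmod (ell2_nth (X i) n - l n))\<^sup>2) \<le> (e/2)\<^sup>2"
      using tail[of "e/2"] by auto
    have "dist (X i) (Abs_ell2 l) < e" if "i \<ge> M" for i
    proof -
      have "(norm (X i - Abs_ell2 l))\<^sup>2 \<le> (e/2)\<^sup>2"
        unfolding norm_ell2_sq minus_ell2.rep_eq L
      proof (rule suminf_le_const)
        show "summable (\<lambda>n. (cmod (ell2_nth (X i) n - l n))\<^sup>2)"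
          by (rule summ) (rule M[OF that])
        show "(\<Sum>n<k. (cmod (ell2_nth (X i) n - l n))\<^sup>2) \<le> (e/2)\<^sup>2" for k
          by (rule M[OF that])
      qed
      then have "norm (X i - Abs_ell2 l) \<le> e/2"
        using \<open>0 < e\<close> by (simp add: power2_le_iff_abs_le)
      then show ?thesis using \<open>0 < e\<close> by (simp add: dist_norm)
    qed
    then show "\<exists>M. \<forall>i\<ge>M. dist (X i) (Abs_ell2 l) < e" by blast
  qed
  then show "convergent X" by (rule convergentI)
qed

instantiation ell2 :: complex_hilbert
begin

lift_definition scaleC_ell2 :: "complex \<Rightarrow> ell2 \<Rightarrow> ell2" is "\<lambda>c x n. c * x n"
  by (rule square_summable_cscale)

definition cinner_ell2 :: "ell2 \<Rightarrow> ell2 \<Rightarrow> complex" where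
  "cinner_ell2 x y = (\<Sum>n. ell2_nth x n * cnj (ell2_nth y n))"

instance
proof
  fix x y z :: ell2 and c d :: complex and r :: real
  show "c *\<^sub>C (x + y) = c *\<^sub>C x + c *\<^sub>C y" by transfer (simp add: algebra_simps)
  show "(c + d) *\<^sub>C x = c *\<^sub>C x + d *\<^sub>C x" by transfer (simp add: algebra_simps)
  show "c *\<^sub>C d *\<^sub>C x = (c * d) *\<^sub>C x" by transfer (simp add: algebra_simps)
  show "r *\<^sub>R x = complex_of_real r *\<^sub>C x" by transfer simp
  show "cinner x y = cnj (cinner y x)"
    unfolding cinner_ell2_def
    by (subst bounded_linear.suminf[OF bounded_linear_cnj summable_ell2_prod]) (simp add: mult.commute)
  show "cinner (x + y) z = cinner x z + cinner y z"
    unfolding cinner_ell2_def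
    by (simp add: plus_ell2.rep_eq distrib_right flip: suminf_add[OF summable_ell2_prod summable_ell2_prod])
  show "cinner (c *\<^sub>C x) y = c * cinner x y"
    unfolding cinner_ell2_def
    by (simp add: scaleC_ell2.rep_eq mult.assoc suminf_mult[OF summable_ell2_prod])
  show "inner x y = Re (cinner x y)" by (simp add: inner_ell2_def cinner_ell2_def)
qed

end


section \<open>Operators on the sequence space\<close>

lift_definition basis_vec :: "nat \<Rightarrow> ell2" is "\<lambda>k n. if n = k then 1 else 0"
  by (rule summable_finite[of "{k}" for k]) auto

lift_definition shift :: "ell2 \<Rightarrow> ell2" is "\<lambda>x n. case n of 0 \<Rightarrow> 0 | Suc m \<Rightarrow> x m"
  by (subst summable_Suc_iff[symmetric]) simp

text \<open>The diagonal operator is meant for bounded \<open>l\<close>; for unbounded \<open>l\<close> the value is a dummy.\<close>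

lift_definition diag_op :: "(nat \<Rightarrow> complex) \<Rightarrow> ell2 \<Rightarrow> ell2" is
  "\<lambda>l x n. if bounded (range l) then l n * x n else 0"
proof -
  fix l x :: "nat \<Rightarrow> complex"
  assume "summable (\<lambda>n. (cmod (x n))\<^sup>2)"
  then show "summable (\<lambda>n. (cmod (if bounded (range l) then l n * x n else 0))\<^sup>2)"
    by (cases "bounded (range l)") (simp_all add: square_summable_mult)
qed

lemma shift_basis_vec: "shift (basis_vec n) = basis_vec (Suc n)"
  by transfer (auto split: nat.splits)

lemma diag_op_basis_vec: "bounded (range l) \<Longrightarrow> diag_op l (basis_vec n) = l n *\<^sub>C basis_vec n"
  by (rule ell2_eqI) (simp add: diag_op.rep_eq basis_vec.rep_eq scaleC_ell2.rep_eq)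

end

theory Submission
  imports Defs
begin

text \<open>Write \<open>T = S D + \<theta>\<close> with \<open>\<theta> x = \<phi>(x) e\<^sub>0\<close> and \<open>\<phi>(x) = \<Sum>n. w\<^sub>n x\<^sub>n\<close>. For an endomorphism
  \<open>(T\<^sub>1, T\<^sub>2)\<close> the relation \<open>T\<^sub>2 S = S T\<^sub>1\<close> turns \<open>T\<^sub>2 T = T T\<^sub>1\<close> into
  \<open>S T\<^sub>1 D x + \<phi>(x) u = S D T\<^sub>1 x + \<phi>(T\<^sub>1 x) e\<^sub>0\<close>, where \<open>u = T\<^sub>2 e\<^sub>0\<close>.
  The range of \<open>S\<close> is orthogonal to \<open>e\<^sub>0\<close>, so this equation splits. The part inside the range of \<open>S\<close>
  says that the commutator of \<open>D\<close> and \<open>T\<^sub>1\<close> has rank at most one: in matrix entries,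
  \<open>(\<lambda>\<^sub>i - \<lambda>\<^sub>j) t\<^sub>i\<^sub>j = u\<^sub>i\<^sub>+\<^sub>1 w\<^sub>j\<close>. But the diagonal of a commutator with \<open>D\<close> vanishes, and no \<open>w\<^sub>j\<close> does,
  so \<open>u\<^sub>i\<^sub>+\<^sub>1 = 0\<close> for all \<open>i\<close>. Hence \<open>u = u\<^sub>0 e\<^sub>0\<close>, and \<open>T\<^sub>1\<close> commutes with \<open>D\<close>;
  as the \<open>\<lambda>\<^sub>i\<close> are distinct, \<open>T\<^sub>1\<close> is diagonal. The part along \<open>e\<^sub>0\<close> is \<open>\<phi> \<circ> T\<^sub>1 = u\<^sub>0 \<phi>\<close>,
  which forces every diagonal entry of \<open>T\<^sub>1\<close> to be \<open>u\<^sub>0\<close>. So \<open>T\<^sub>1\<close> and \<open>T\<^sub>2\<close> multiply every basis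
  vector by \<open>u\<^sub>0\<close>, and by continuity they are both scalar (\<open>bounded_clinear_scalarI\<close>).\<close>

section \<open>Scalars and the inner product in complex Hilbert spaces\<close>

lemma scaleC_zero_right [simp]: "c *\<^sub>C (0::'a::complex_hilbert) = 0"
  using scaleC_add_right[of c "0::'a" 0] by simp

lemma scaleC_left_commute: "c *\<^sub>C d *\<^sub>C x = d *\<^sub>C c *\<^sub>C (x::'a::complex_hilbert)"
  by (simp add: scaleC_scaleC mult.commute)

lemma cinner_scaleC_right: "cinner x (c *\<^sub>C y) = cnj c * cinner x (y::'a::complex_hilbert)"
  by (metis cinner_commute cinner_scaleC_left complex_cnj_mult)

lemma norm_scaleC: "norm (c *\<^sub>C x) = cmod c * norm (x::'a::complex_hilbert)"
proof -
  have "cinner (c *\<^sub>C x) (c *\<^sub>C x) = complex_of_real ((cmod c)\<^sup>2) * cinner x x"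
    unfolding cinner_scaleC_left cinner_scaleC_right complex_norm_square by simp
  then have "(norm (c *\<^sub>C x))\<^sup>2 = (cmod c * norm x)\<^sup>2"
    by (simp add: power2_norm_eq_inner inner_eq_Re_cinner power_mult_distrib del: of_real_power)
  then show ?thesis by simp
qed

text \<open>Turning \<open>x\<close> by a phase makes \<open>cinner x y\<close> real and nonnegative, so that the Cauchy-Schwarz
  inequality of the underlying real inner product applies.\<close>

lemma cmod_cinner_le: "cmod (cinner x y) \<le> norm x * norm (y::'a::complex_hilbert)"
proof (cases "cinner x y = 0")
  case False
  define c where "c = cnj (cinner x y) / complex_of_real (cmod (cinner x y))"
  have c: "cmod c = 1"
    using False by (simp add: c_def norm_divide)
  have "c * cinner x y = complex_of_real (cmod (cinner x y))"
    using False complex_norm_square[of "cinner x y"]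
    by (simp add: c_def divide_eq_eq power2_eq_square mult.commute[of "cnj _"])
  then have "cmod (cinner x y) = inner (c *\<^sub>C x) y"
    by (simp add: inner_eq_Re_cinner cinner_scaleC_left)
  also have "\<dots> \<le> norm (c *\<^sub>C x) * norm y"
    by (rule norm_cauchy_schwarz)
  finally show ?thesis by (simp add: norm_scaleC c)
qed simp


section \<open>Bounded complex-linear maps\<close>

lemma bounded_clinearI:
  fixes f :: "'a::complex_hilbert \<Rightarrow> 'b::complex_hilbert"
  assumes "\<And>x y. f (x + y) = f x + f y" "\<And>c x. f (c *\<^sub>C x) = c *\<^sub>C f x"
    and "\<And>x. norm (f x) \<le> norm x * K"
  shows "bounded_clinear f"
  unfolding bounded_clinear_def
  using assms by (auto intro!: bounded_linear_intro[where K = K] simp: scaleR_scaleC)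

lemma bounded_clinear_add:
  "bounded_clinear f \<Longrightarrow> bounded_clinear g \<Longrightarrow> bounded_clinear (\<lambda>x. f x + g x)"
  by (simp add: bounded_clinear_def bounded_linear_add scaleC_add_right)

lemma bounded_clinear_compose:
  "bounded_clinear f \<Longrightarrow> bounded_clinear g \<Longrightarrow> bounded_clinear (\<lambda>x. f (g x))"
  by (simp add: bounded_clinear_def bounded_linear_compose)

lemma bounded_clinear_scaleC: "bounded_clinear (\<lambda>x::'a::complex_hilbert. c *\<^sub>C x)"
  by (rule bounded_clinearI[where K = "cmod c"])
    (simp_all add: scaleC_add_right scaleC_left_commute norm_scaleC mult.commute)

lemma bounded_clinear_rank_one: "bounded_clinear (rank_one a b)"
proof (rule bounded_clinearI[where K = "norm b * norm a"])
  show "norm (rank_one a b x) \<le> norm x * (norm b * norm a)" for x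
    using mult_right_mono[OF cmod_cinner_le[of x b] norm_ge_zero[of a]]
    by (simp add: rank_one_def norm_scaleC mult.assoc)
qed (simp_all add: rank_one_def cinner_add_left scaleC_add_left cinner_scaleC_left scaleC_scaleC)

lemma bounded_clinear_shift: "bounded_clinear shift"
proof (rule bounded_clinearI[where K = 1])
  fix x y :: ell2 and c :: complex
  show "shift (x + y) = shift x + shift y"
    by transfer (auto split: nat.splits)
  show "shift (c *\<^sub>C x) = c *\<^sub>C shift x"
    by transfer (auto split: nat.splits)
  have "(norm (shift x))\<^sup>2 = (norm x)\<^sup>2"
    unfolding norm_ell2_sq
    using suminf_split_head[OF summable_ell2_nth[of "shift x"]] by (simp add: shift.rep_eq)
  then show "norm (shift x) \<le> norm x * 1" by simp
qed

lemma bounded_clinear_diag_op: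
  assumes "bounded (range l)"
  shows "bounded_clinear (diag_op l)"
proof -
  obtain B where B: "\<And>n. cmod (l n) \<le> B"
    using assms by (auto simp: bounded_iff)
  then have "0 \<le> B"
    by (meson norm_ge_zero order_trans)
  show ?thesis
  proof (rule bounded_clinearI[where K = B])
    fix x y :: ell2 and c :: complex
    show "diag_op l (x + y) = diag_op l x + diag_op l y"
      by (rule ell2_eqI) (simp add: diag_op.rep_eq plus_ell2.rep_eq distrib_left)
    show "diag_op l (c *\<^sub>C x) = c *\<^sub>C diag_op l x"
      by (rule ell2_eqI) (simp add: diag_op.rep_eq scaleC_ell2.rep_eq)
    have "(norm (diag_op l x))\<^sup>2 \<le> (\<Sum>n. B\<^sup>2 * (cmod (ell2_nth x n))\<^sup>2)"
      unfolding norm_ell2_sq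
    proof (rule suminf_le)
      show "(cmod (ell2_nth (diag_op l x) n))\<^sup>2 \<le> B\<^sup>2 * (cmod (ell2_nth x n))\<^sup>2" for n
        using B[of n] assms
        by (auto simp: diag_op.rep_eq norm_mult power_mult_distrib intro!: mult_right_mono power_mono)
    qed (intro summable_mult summable_ell2_nth)+
    also have "\<dots> = (norm x * B)\<^sup>2"
      by (simp add: norm_ell2_sq power_mult_distrib suminf_mult summable_ell2_nth mult.commute)
    finally show "norm (diag_op l x) \<le> norm x * B"
      by (rule power2_le_imp_le) (simp add: \<open>0 \<le> B\<close>)
  qed
qed


section \<open>Determination of a bounded operator by its values on the basis\<close>

lemma ell2_nth_sum: "ell2_nth (sum f A) n = (\<Sum>i\<in>A. ell2_nth (f i) n)"
  by (induction A rule: infinite_finite_induct) (simp_all add: zero_ell2.rep_eq plus_ell2.rep_eq)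

text \<open>The squared error of the \<open>k\<close>-th partial sum is the tail from \<open>k\<close> on of the convergent
  series for \<open>(norm x)\<^sup>2\<close>.\<close>

lemma basis_expansion: "(\<lambda>n. ell2_nth x n *\<^sub>C basis_vec n) sums x"
  unfolding sums_def
proof (rule LIMSEQ_I)
  let ?p = "\<lambda>k. \<Sum>n<k. ell2_nth x n *\<^sub>C basis_vec n"
  let ?a = "\<lambda>n. (cmod (ell2_nth x n))\<^sup>2"
  fix e :: real
  assume "0 < e"
  have coord: "ell2_nth (?p k - x) n = (if n < k then 0 else - ell2_nth x n)" for k n
    by (simp add: minus_ell2.rep_eq ell2_nth_sum scaleC_ell2.rep_eq basis_vec.rep_eq if_distrib
        cong: if_cong)
  have tail: "(norm (?p k - x))\<^sup>2 = (\<Sum>n. ?a (n + k))" for k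
    unfolding norm_ell2_sq
    by (subst suminf_split_initial_segment[OF summable_ell2_nth, of _ k]) (simp add: coord)
  obtain N where "\<And>k. k \<ge> N \<Longrightarrow> norm (\<Sum>n. ?a (n + k)) < e\<^sup>2"
    using suminf_exist_split[OF _ summable_ell2_nth[of x], of "e\<^sup>2"] \<open>0 < e\<close> by auto
  then have "(norm (?p k - x))\<^sup>2 < e\<^sup>2" if "k \<ge> N" for k
    using that by (fastforce simp: tail)
  then have "norm (?p k - x) < e" if "k \<ge> N" for k
    using that \<open>0 < e\<close> by (intro power2_less_imp_less[of _ e]) simp_all
  then show "\<exists>N. \<forall>k\<ge>N. norm (?p k - x) < e" by blast
qed

text \<open>Continuity carries \<open>f\<close> through the basis expansion of its argument, term by term.\<close>

lemma bounded_clinear_scalarI: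
  assumes f: "bounded_clinear f" and eig: "\<And>n. f (basis_vec n) = c *\<^sub>C basis_vec n"
  shows "f = (\<lambda>x. c *\<^sub>C x)"
proof
  fix x
  have "(\<lambda>n. g (ell2_nth x n *\<^sub>C basis_vec n)) sums g x" if "bounded_clinear g" for g :: "ell2 \<Rightarrow> ell2"
    using that by (intro bounded_linear.sums[OF _ basis_expansion]) (simp add: bounded_clinear_def)
  from this[OF f] this[OF bounded_clinear_scaleC[of c]] show "f x = c *\<^sub>C x"
    using f by (intro sums_unique2[of "\<lambda>n. f (ell2_nth x n *\<^sub>C basis_vec n)"])
      (simp_all add: bounded_clinear_def eig scaleC_left_commute)
qed


section \<open>Transitivity\<close>

theorem theorem3p7:
  fixes l w :: "nat \<Rightarrow> complex" and wbar :: ell2 and T :: "ell2 \<Rightarrow> ell2"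
  assumes l_bounded: "bounded (range l)"
    and l_distinct: "\<And>i j. i \<noteq> j \<Longrightarrow> l i \<noteq> l j"
    and wbar: "\<And>n. ell2_nth wbar n = cnj (w n)"
    and w_nonzero: "\<And>n. w n \<noteq> 0"
    and T_def: "T = (\<lambda>x. shift (diag_op l x) + rank_one (basis_vec 0) wbar x)"
  shows "kronecker_rep shift T \<and> transitive_rep shift T"
proof
  have T: "bounded_clinear T"
    unfolding T_def
    by (intro bounded_clinear_add bounded_clinear_rank_one
        bounded_clinear_compose[OF bounded_clinear_shift] bounded_clinear_diag_op l_bounded)
  then show "kronecker_rep shift T"
    by (simp add: kronecker_rep_def bounded_clinear_shift)
  have T_nth_0: "ell2_nth (T x) 0 = cinner x wbar" for x
    by (simp add: T_def plus_ell2.rep_eq shift.rep_eq rank_one_def scaleC_ell2.rep_eq basis_vec.rep_eq)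
  have T_nth_Suc: "ell2_nth (T x) (Suc i) = l i * ell2_nth x i" for x i
    by (simp add: T_def plus_ell2.rep_eq shift.rep_eq rank_one_def scaleC_ell2.rep_eq
        basis_vec.rep_eq diag_op.rep_eq l_bounded)
  have cinner_basis: "cinner (basis_vec j) wbar = w j" for j
    using suminf_finite[of "{j}" "\<lambda>n. ell2_nth (basis_vec j) n * cnj (ell2_nth wbar n)"]
    by (simp add: cinner_ell2_def basis_vec.rep_eq wbar)
  have T_basis: "T (basis_vec j) = l j *\<^sub>C basis_vec (Suc j) + w j *\<^sub>C basis_vec 0" for j
    using bounded_clinear_shift
    by (simp add: T_def diag_op_basis_vec l_bounded bounded_clinear_def shift_basis_vec
        rank_one_def cinner_basis)
  have scalar: "\<exists>c. T1 = (\<lambda>x. c *\<^sub>C x) \<and> T2 = (\<lambda>x. c *\<^sub>C x)" if E: "(T1, T2) \<in> End shift T" for T1 T2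
  proof -
    from E have T1: "bounded_clinear T1" and T2: "bounded_clinear T2"
      and S_comm: "\<And>x. T2 (shift x) = shift (T1 x)" and T_comm: "\<And>x. T2 (T x) = T (T1 x)"
      by (auto simp: End_def fun_eq_iff)
    define u where "u = T2 (basis_vec 0)"
    have T2_Suc: "T2 (basis_vec (Suc j)) = shift (T1 (basis_vec j))" for j
      using S_comm[of "basis_vec j"] by (simp add: shift_basis_vec)
    have key: "T (T1 (basis_vec j)) = l j *\<^sub>C shift (T1 (basis_vec j)) + w j *\<^sub>C u" for j
      using T_comm[of "basis_vec j"] T2
      by (simp add: T_basis bounded_clinear_def linear_add bounded_linear.linear T2_Suc u_def)
    \<comment> \<open>The two sides of \<open>key\<close> are compared in their coordinates other than \<open>0\<close>, which see the
      range of \<open>shift\<close>, and then in coordinate \<open>0\<close>, where every vector \<open>shift x\<close> vanishes.\<close>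
    have range_part: "(l i - l j) * ell2_nth (T1 (basis_vec j)) i = w j * ell2_nth u (Suc i)" for i j
      using T_nth_Suc[of "T1 (basis_vec j)" i]
      by (simp add: key plus_ell2.rep_eq scaleC_ell2.rep_eq shift.rep_eq left_diff_distrib
          diff_eq_eq add.commute)
    have e0_part: "cinner (T1 (basis_vec j)) wbar = w j * ell2_nth u 0" for j
      using T_nth_0[of "T1 (basis_vec j)"]
      by (simp add: key plus_ell2.rep_eq scaleC_ell2.rep_eq shift.rep_eq)
    have u_Suc: "ell2_nth u (Suc i) = 0" for i
      using range_part[of i i] w_nonzero[of i] by simp
    have off_diag: "ell2_nth (T1 (basis_vec j)) i = 0" if "i \<noteq> j" for i j
      using range_part[of i j] l_distinct[OF that] by (simp add: u_Suc)
    have T1_diag: "T1 (basis_vec j) = ell2_nth (T1 (basis_vec j)) j *\<^sub>C basis_vec j" for j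
      by (rule ell2_eqI) (simp add: scaleC_ell2.rep_eq basis_vec.rep_eq off_diag)
    have "ell2_nth (T1 (basis_vec j)) j = ell2_nth u 0" for j
    proof -
      have "cinner (T1 (basis_vec j)) wbar = ell2_nth (T1 (basis_vec j)) j * w j"
        by (subst T1_diag) (simp add: cinner_scaleC_left cinner_basis)
      then show ?thesis
        using e0_part[of j] w_nonzero[of j] by simp
    qed
    then have T1_basis: "T1 (basis_vec j) = ell2_nth u 0 *\<^sub>C basis_vec j" for j
      using T1_diag[of j] by simp
    have "u = ell2_nth u 0 *\<^sub>C basis_vec 0"
    proof (rule ell2_eqI)
      show "ell2_nth u n = ell2_nth (ell2_nth u 0 *\<^sub>C basis_vec 0) n" for n
        by (cases n) (simp_all add: scaleC_ell2.rep_eq basis_vec.rep_eq u_Suc)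
    qed
    then have "T2 (basis_vec n) = ell2_nth u 0 *\<^sub>C basis_vec n" for n
      using bounded_clinear_shift
      by (cases n) (simp_all add: u_def T2_Suc T1_basis bounded_clinear_def shift_basis_vec)
    then show ?thesis
      using bounded_clinear_scalarI[OF T1 T1_basis] bounded_clinear_scalarI[OF T2] by blast
  qed
  have "((\<lambda>x. c *\<^sub>C x), (\<lambda>y. c *\<^sub>C y)) \<in> End shift T" for c
    using T bounded_clinear_shift bounded_clinear_scaleC[where 'a = ell2, of c]
    by (simp add: End_def bounded_clinear_def fun_eq_iff)
  with scalar show "transitive_rep shift T"
    unfolding transitive_rep_def by fast
qed

end
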